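(* Let $n \geq 2$ be an integer. The conformal dimension of Lebesgue measure on $\mathbb{R}^n$ (with the Euclidean metric) is zero.
   Context: A homeomorphism $f\colon (X,d_X) \rightarrow (Y,d_Y)$ between metric spaces is quasisymmetric if there exists a homeomorphism $\eta\colon [0, \infty) \rightarrow [0, \infty)$ such that $$\frac{d_Y(f(x),f(y))}{d_Y(f(x),f(z))} \leq \eta\left( \frac{d_X(x,y)}{d_X(x,z)} \right)$$ for all triples of distinct points $x,y,z \in X$. The conformal dimension of a locally finite Borel measure $\mu$ on a metric space $Z$ is the infimum of the Hausdorff dimensions $\dim_H f(E)$, taken over all quasisymmetric mappings $f$ of $Z$ onto any metric space and all Borel sets $E \subset Z$ of full $\mu$-measure (i.e. $\mu(Z \setminus E) = 0$). *)

theory Defs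
  imports "HOL-Analysis.Analysis"
begin

definition quasisymmetric_map :: "'a metric \<Rightarrow> 'b metric \<Rightarrow> ('a \<Rightarrow> 'b) \<Rightarrow> bool" where
  "quasisymmetric_map X Y f \<longleftrightarrow>
     homeomorphic_map (mtopology_of X) (mtopology_of Y) f \<and>
     (\<exists>\<eta> \<theta> :: real \<Rightarrow> real. homeomorphism {0..} {0..} \<eta> \<theta> \<and>
       (\<forall>x \<in> mspace X. \<forall>y \<in> mspace X. \<forall>z \<in> mspace X.
          x \<noteq> y \<and> y \<noteq> z \<and> x \<noteq> z \<longrightarrow>
          mdist Y (f x) (f y) / mdist Y (f x) (f z) \<le> \<eta> (mdist X x y / mdist X x z)))"

definition ediam :: "'a metric \<Rightarrow> 'a set \<Rightarrow> ennreal" where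
  "ediam X U = (SUP x\<in>U. SUP y\<in>U. ennreal (mdist X x y))"

text \<open>The term that a set \<open>U\<close> of finite diameter contributes to the sums defining the
  \<open>s\<close>-dimensional Hausdorff measure. Since \<open>0 powr 0 = 0\<close>, the case \<open>s = 0\<close> has to be
  treated separately in order to obtain the counting measure.\<close>

definition diam_power :: "'a metric \<Rightarrow> real \<Rightarrow> 'a set \<Rightarrow> ennreal" where
  "diam_power X s U =
     (if U = {} then 0 else if s = 0 then 1 else ennreal (enn2real (ediam X U) powr s))"

definition hausdorff_premeasure :: "'a metric \<Rightarrow> real \<Rightarrow> real \<Rightarrow> 'a set \<Rightarrow> ennreal" where
  "hausdorff_premeasure X s \<delta> A =
     Inf {(\<Sum>i. diam_power X s (U i)) | U :: nat \<Rightarrow> 'a set.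
            (\<forall>i. U i \<subseteq> mspace X \<and> ediam X (U i) \<le> ennreal \<delta>) \<and> A \<subseteq> (\<Union>i. U i)}"

definition hausdorff_measure :: "'a metric \<Rightarrow> real \<Rightarrow> 'a set \<Rightarrow> ennreal" where
  "hausdorff_measure X s A = (SUP \<delta>\<in>{0<..}. hausdorff_premeasure X s \<delta> A)"

definition hausdorff_dim :: "'a metric \<Rightarrow> 'a set \<Rightarrow> ennreal" where
  "hausdorff_dim X A = Inf {ennreal s | s. 0 \<le> s \<and> hausdorff_measure X s A = 0}"

text \<open>The target \<open>Y\<close> ranges over the metric spaces whose points belong to the type \<open>'a\<close>. This
  is no restriction, because \<open>f\<close> is a bijection and the metric of any other target can be pulled
  back along it; see \<open>conformal_dimension_le\<close> below, where the target type is arbitrary.\<close>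

definition conformal_dimension :: "'a::metric_space measure \<Rightarrow> ennreal" where
  "conformal_dimension \<mu> =
     Inf {hausdorff_dim Y (f ` E) | (Y :: 'a metric) f E.
            quasisymmetric_map euclidean_metric Y f \<and>
            E \<in> sets borel \<and> emeasure \<mu> (UNIV - E) = 0}"

lemma hausdorff_dim_isometry_le:
  fixes X :: "'a metric" and Y :: "'b metric"
  assumes bij: "bij_betw f (mspace X) (mspace Y)"
    and iso: "\<And>x y. x \<in> mspace X \<Longrightarrow> y \<in> mspace X \<Longrightarrow> mdist Y (f x) (f y) = mdist X x y"
    and A: "A \<subseteq> mspace X"
  shows "hausdorff_dim X A \<le> hausdorff_dim Y (f ` A)"
proof -
  have pre: "hausdorff_premeasure X s \<delta> A \<le> hausdorff_premeasure Y s \<delta> (f ` A)" for s \<delta>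
    unfolding hausdorff_premeasure_def
  proof (rule Inf_mono)
    fix b
    assume "b \<in> {(\<Sum>i. diam_power Y s (U i)) | U :: nat \<Rightarrow> 'b set.
            (\<forall>i. U i \<subseteq> mspace Y \<and> ediam Y (U i) \<le> ennreal \<delta>) \<and> f ` A \<subseteq> (\<Union>i. U i)}"
    then obtain U where b: "b = (\<Sum>i. diam_power Y s (U i))"
      and U: "\<And>i. U i \<subseteq> mspace Y" "\<And>i. ediam Y (U i) \<le> ennreal \<delta>" "f ` A \<subseteq> (\<Union>i. U i)"
      by blast
    define V where "V i = {x \<in> mspace X. f x \<in> U i}" for i
    have fV: "f ` V i = U i" for i
      using U(1)[of i] bij unfolding V_def bij_betw_def by auto
    have "(SUP y\<in>f ` V i. SUP y'\<in>f ` V i. ennreal (mdist Y y y'))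
            = (SUP x\<in>V i. SUP x'\<in>V i. ennreal (mdist X x x'))" for i
      unfolding image_image by (intro SUP_cong refl) (auto simp: V_def iso)
    then have e: "ediam X (V i) = ediam Y (U i)" for i
      by (simp add: ediam_def fV)
    have "V i = {} \<longleftrightarrow> U i = {}" for i
      using fV[of i] by auto
    then have "diam_power X s (V i) = diam_power Y s (U i)" for i
      by (simp add: diam_power_def e)
    then have "b = (\<Sum>i. diam_power X s (V i))"
      by (simp add: b)
    moreover have "A \<subseteq> (\<Union>i. V i)"
      using U(3) A by (auto simp: V_def)
    moreover have "V i \<subseteq> mspace X" for i
      by (auto simp: V_def)
    ultimately show "\<exists>a\<in>{(\<Sum>i. diam_power X s (U i)) | U :: nat \<Rightarrow> 'a set.
            (\<forall>i. U i \<subseteq> mspace X \<and> ediam X (U i) \<le> ennreal \<delta>) \<and> A \<subseteq> (\<Union>i. U i)}. a \<le> b"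
      using e U(2) by (intro bexI[of _ b]) (auto intro!: exI[of _ V])
  qed
  have "hausdorff_measure X s A \<le> hausdorff_measure Y s (f ` A)" for s
    unfolding hausdorff_measure_def by (intro SUP_mono) (use pre in auto)
  then show ?thesis
    unfolding hausdorff_dim_def
    by (intro Inf_superset_mono) (auto simp flip: le_zero_eq intro: order_trans)
qed

lemma conformal_dimension_le:
  fixes \<mu> :: "'a::metric_space measure" and Y :: "'b metric"
  assumes f: "quasisymmetric_map euclidean_metric Y f"
    and E: "E \<in> sets borel" "emeasure \<mu> (UNIV - E) = 0"
  shows "conformal_dimension \<mu> \<le> hausdorff_dim Y (f ` E)"
proof -
  from f have hom: "homeomorphic_map euclidean (mtopology_of Y) f"
    by (simp add: quasisymmetric_map_def)
  then have bij: "bij_betw f UNIV (mspace Y)"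
    using homeomorphic_imp_injective_map homeomorphic_imp_surjective_map
    by (fastforce simp: bij_betw_def)
  then have inj: "inj f" and fY: "f x \<in> mspace Y" for x
    by (auto simp: bij_betw_def)
  define d where "d x y = mdist Y (f x) (f y)" for x y
  have M: "Metric_space UNIV d"
    by unfold_locales (use inj fY in \<open>auto simp: d_def mdist_commute mdist_triangle inj_eq\<close>)
  define X where "X = metric (UNIV, d)"
  have X [simp]: "mspace X = UNIV" "mdist X = d"
    by (simp_all add: X_def Metric_space.mspace_metric[OF M] Metric_space.mdist_metric[OF M])
  define g where "g = the_inv f"
  have gf: "g (f x) = x" for x
    by (simp add: g_def the_inv_f_f inj)
  have fg: "f (g y) = y" if "y \<in> mspace Y" for y
    using that bij gf by (metis bij_betw_imp_surj_on imageE)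
  have "Lipschitz_continuous_map X Y f"
    unfolding Lipschitz_continuous_map_def
    by (auto simp: fY d_def intro: exI[of _ 1])
  moreover have "Lipschitz_continuous_map Y X g"
    unfolding Lipschitz_continuous_map_def
    by (auto simp: fg d_def intro: exI[of _ 1])
  ultimately have "homeomorphic_maps (mtopology_of Y) (mtopology_of X) g f"
    by (auto simp: homeomorphic_maps_def Lipschitz_continuous_imp_continuous_map fg gf)
  then have "homeomorphic_map (mtopology_of Y) (mtopology_of X) g"
    using homeomorphic_maps_map by blast
  from homeomorphic_map_compose[OF hom this]
  have "homeomorphic_map euclidean (mtopology_of X) id"
    by (simp add: gf o_def id_def)
  then have "quasisymmetric_map euclidean_metric X id"
    using f by (simp add: quasisymmetric_map_def d_def)
  then have "conformal_dimension \<mu> \<le> hausdorff_dim X (id ` E)"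
    unfolding conformal_dimension_def using E by (intro Inf_lower) blast
  also have "\<dots> \<le> hausdorff_dim Y (f ` E)"
    using hausdorff_dim_isometry_le[of f X Y E] bij by (simp add: d_def)
  finally show ?thesis .
qed

end

theory Submission
  imports Defs
begin

text \<open>Give a triadic cube of level \<open>m\<close> in \<open>\<real>^n\<close> the weight \<open>2^(-m - e c)\<close>, where \<open>c\<close> counts the
  ancestors that are the middle one of the \<open>3^n\<close> subcubes of their parent. The weights of adjacent
  cubes are comparable, since a middle subcube does not touch the boundary of its parent. There is a
  metric for which the diameter of every cube is comparable to its weight: the functions that vary
  by at most the weight on each cube separate points well enough, because the Cantor function of a
  single coordinate is one of them, however small the weight of the middle subcubes. The identity is
  then quasisymmetric. Almost every point lies in middle subcubes at a positive proportion of the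
  levels, so for large \<open>e\<close> the \<open>3^(n m)\<close> subcubes of a unit cube that matter at level \<open>m\<close> have
  diameters so small that the sum of their powers with a given exponent \<open>s > 0\<close> tends to \<open>0\<close>.\<close>

section \<open>The Cantor function\<close>

text \<open>\<open>K\<close> stands for the interval from \<open>K / 3^l\<close> to
  \<open>(K + 1) / 3^l\<close>. Its last \<open>l\<close> ternary digits avoid 1 exactly if it is an
  interval of stage \<open>l\<close> in the construction of the Cantor set, repeated in every unit
  interval.\<close>

primrec cantor_free :: "nat \<Rightarrow> int \<Rightarrow> bool" where
  "cantor_free 0 K \<longleftrightarrow> True"
| "cantor_free (Suc l) K \<longleftrightarrow> cantor_free l (K div 3) \<and> K mod 3 \<noteq> 1"

text \<open>Divided by \<open>2^l\<close>, this is the value at \<open>K / 3^l\<close> of the Cantor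
  function, extended to the line by F(t + 1) = F(t) + 1.\<close>

primrec cantor_count :: "nat \<Rightarrow> int \<Rightarrow> int" where
  "cantor_count 0 K = K"
| "cantor_count (Suc l) K = 2 * cantor_count l (K div 3)
     + (if cantor_free l (K div 3) \<and> K mod 3 \<noteq> 0 then 1 else 0)"

text \<open>A last digit 2 carries into the parent, where the induction hypothesis gives twice the
  increment; half of it cancels against the contribution of the digit 2.\<close>

lemma cantor_count_succ:
  "cantor_count l (K + 1) = cantor_count l K + (if cantor_free l K then 1 else 0)"
proof (induction l arbitrary: K)
  case (Suc l)
  consider "K mod 3 = 0" | "K mod 3 = 1" | "K mod 3 = 2" by linarith
  then show ?case
  proof cases
    case 1
    then have "(K + 1) div 3 = K div 3" "(K + 1) mod 3 = 1" by presburger+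
    with 1 show ?thesis by simp
  next
    case 2
    then have "(K + 1) div 3 = K div 3" "(K + 1) mod 3 = 2" by presburger+
    with 2 show ?thesis by simp
  next
    case 3
    then have "(K + 1) div 3 = K div 3 + 1" "(K + 1) mod 3 = 0" by presburger+
    with 3 Suc[of "K div 3"] show ?thesis by simp
  qed
qed simp

lemma cantor_count_mono: "K \<le> L \<Longrightarrow> cantor_count l K \<le> cantor_count l L"
  by (induction L rule: int_ge_induct) (auto simp: cantor_count_succ)

text \<open>The increment of the Cantor function over the interval of level \<open>l\<close> that
  contains \<open>t\<close>.\<close>

definition cantor_mass :: "nat \<Rightarrow> real \<Rightarrow> real" where
  "cantor_mass l t = (if cantor_free l \<lfloor>3 ^ l * t\<rfloor> then 1 / 2 ^ l else 0)"

definition cantor_approx :: "nat \<Rightarrow> real \<Rightarrow> real" where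
  "cantor_approx l t = cantor_count l \<lfloor>3 ^ l * t\<rfloor> / 2 ^ l"

definition cantor_fun :: "real \<Rightarrow> real" where
  "cantor_fun t = (SUP l. cantor_approx l t)"

lemma floor_power_3_Suc: "\<lfloor>3 ^ Suc l * t\<rfloor> div 3 = \<lfloor>3 ^ l * (t::real)\<rfloor>"
  using floor_divide_real_eq_div[of 3 "3 ^ Suc l * t"] by simp

lemma cantor_mass_nonneg: "0 \<le> cantor_mass l t"
  by (simp add: cantor_mass_def)

text \<open>\<open>cantor_approx\<close> and \<open>cantor_approx + cantor_mass\<close> are the
  values of the Cantor function at the two ends of the interval of level \<open>l\<close> around
  \<open>t\<close>, and these intervals are nested.\<close>

lemma cantor_approx_Suc:
  "cantor_approx l t \<le> cantor_approx (Suc l) t"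
  "cantor_approx (Suc l) t + cantor_mass (Suc l) t \<le> cantor_approx l t + cantor_mass l t"
  unfolding cantor_approx_def cantor_mass_def cantor_count.simps cantor_free.simps
    floor_power_3_Suc
  by (auto simp: field_simps)

lemma cantor_fun_bounds:
  "cantor_approx l t \<le> cantor_fun t" "cantor_fun t \<le> cantor_approx l t + cantor_mass l t"
proof -
  have up: "cantor_approx i t \<le> cantor_approx j t" if "i \<le> j" for i j
    using that by (rule lift_Suc_mono_le[rotated]) (rule cantor_approx_Suc)
  have down: "cantor_approx j t + cantor_mass j t \<le> cantor_approx i t + cantor_mass i t"
    if "i \<le> j" for i j
    using that by (rule lift_Suc_antimono_le[rotated]) (rule cantor_approx_Suc)
  \<comment> \<open>At the common level \<open>max i j\<close> every lower bound is seen to lie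
    below every upper bound, which squeezes the supremum between them.\<close>
  have le: "cantor_approx i t \<le> cantor_approx j t + cantor_mass j t" for i j
    using up[of i "max i j"] down[of j "max i j"] cantor_mass_nonneg[of "max i j" t] by linarith
  show "cantor_approx l t \<le> cantor_fun t"
    unfolding cantor_fun_def using le by (intro cSUP_upper bdd_aboveI2[where M="cantor_approx 0 t + cantor_mass 0 t"]) auto
  show "cantor_fun t \<le> cantor_approx l t + cantor_mass l t"
    unfolding cantor_fun_def using le by (intro cSUP_least) auto
qed

text \<open>Points this close lie in the same interval of level \<open>l\<close> or in adjacent
  ones. A bound by the masses at both points matches the shape of the condition in
  \<open>admissible\<close>.\<close>

lemma cantor_fun_diff_le:
  assumes "\<bar>s - t\<bar> \<le> 1 / 3 ^ l"
  shows "\<bar>cantor_fun s - cantor_fun t\<bar> \<le> cantor_mass l s + cantor_mass l t"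
proof -
  have *: "\<bar>cantor_fun s - cantor_fun t\<bar> \<le> cantor_mass l s + cantor_mass l t"
    if "s \<le> t" "t - s \<le> 1 / 3 ^ l" for s t
  proof -
    let ?K = "\<lfloor>3 ^ l * s\<rfloor>" and ?L = "\<lfloor>3 ^ l * t\<rfloor>"
    have "3 ^ l * t \<le> 3 ^ l * s + 1"
      using that(2) by (simp add: field_simps)
    then have "?L \<le> ?K + 1"
      by linarith
    moreover have "?K \<le> ?L"
      using that(1) by (intro floor_mono) simp
    ultimately have "cantor_count l ?K \<le> cantor_count l ?L"
      "cantor_count l ?L \<le> cantor_count l ?K + (if cantor_free l ?K then 1 else 0)"
      using cantor_count_mono[of ?K ?L l] cantor_count_mono[of ?L "?K + 1" l] by (auto simp: cantor_count_succ)
    then have "cantor_approx l s \<le> cantor_approx l t"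
      "cantor_approx l t \<le> cantor_approx l s + cantor_mass l s"
      unfolding cantor_approx_def cantor_mass_def
      by (auto simp: divide_right_mono field_simps split: if_splits)
    then show ?thesis
      using cantor_fun_bounds[where l = l and t = s] cantor_fun_bounds[where l = l and t = t] cantor_mass_nonneg[of l s]
        cantor_mass_nonneg[of l t] by linarith
  qed
  show ?thesis
    using *[of s t] *[of t s] assms by (cases "s \<le> t") (auto simp: abs_minus_commute add.commute)
qed

lemma cantor_fun_floor: "\<lfloor>t\<rfloor> \<le> cantor_fun t" "cantor_fun t \<le> \<lfloor>t\<rfloor> + 1"
  using cantor_fun_bounds[where l = 0 and t = t] by (simp_all add: cantor_approx_def cantor_mass_def)

text \<open>The function stays between the floor and the floor plus 1, and here the floors differ by
  at least 2. All lower bounds for the new metric come from this.\<close>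

lemma cantor_fun_separates:
  assumes "2 \<le> \<bar>s - t\<bar>"
  shows "1 \<le> \<bar>cantor_fun s - cantor_fun t\<bar>"
proof -
  have "1 \<le> cantor_fun s - cantor_fun t" if "2 \<le> s - t" for s t
  proof -
    have "\<lfloor>t\<rfloor> + 2 \<le> \<lfloor>s\<rfloor>"
      using that by linarith
    then show ?thesis
      using cantor_fun_floor[of s] cantor_fun_floor[of t] by linarith
  qed
  from this[of s t] this[of t s] assms show ?thesis by linarith
qed

section \<open>Weights of triadic cubes\<close>

text \<open>\<open>K\<close> indexes the cube of level \<open>m\<close> with corner
  \<open>K / 3^m\<close>. The vector of last digits is its position in the parent, and the middle
  position has all digits 1.\<close>

primrec core_count :: "nat \<Rightarrow> ('n \<Rightarrow> int) \<Rightarrow> nat" where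
  "core_count 0 K = 0"
| "core_count (Suc m) K = core_count m (\<lambda>i. K i div 3) + (if \<forall>i. K i mod 3 = 1 then 1 else 0)"

text \<open>Adjacent cubes with different parents are not middle subcubes, so only the first level at which
  their ancestors differ can contribute to the difference.\<close>

lemma core_count_adjacent:
  assumes "\<And>i. \<bar>K i - L i\<bar> \<le> 1"
  shows "core_count m K \<le> core_count m L + 1"
  using assms
proof (induction m arbitrary: K L)
  case (Suc m)
  show ?case
  proof (cases "\<forall>i. K i div 3 = L i div 3")
    case False
    then obtain i where i: "K i div 3 \<noteq> L i div 3" by blast
    have "K i mod 3 \<noteq> 1"
      using Suc.prems[of i] i by presburger
    moreover have "\<bar>K i div 3 - L i div 3\<bar> \<le> 1" for i
      using Suc.prems[of i] by presburger
    ultimately show ?thesis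
      using Suc.IH[of "\<lambda>i. K i div 3" "\<lambda>i. L i div 3"] by auto
  qed simp
qed simp

text \<open>A middle subcube has last digit 1 in every coordinate, so a single coordinate whose
  digits avoid 1 excludes it at each of these levels.\<close>

lemma core_count_eq_0:
  assumes "cantor_free l (K i)" "m \<le> l"
  shows "core_count m K = 0"
  using assms
proof (induction m arbitrary: l K)
  case (Suc m)
  then obtain l' where "l = Suc l'" by (cases l) auto
  with Suc.prems Suc.IH[of l' "\<lambda>i. K i div 3"] show ?case by auto
qed simp

lemma core_count_add:
  assumes "cantor_free l (K i)"
  shows "core_count (m + l) K = core_count m (\<lambda>i. K i div 3 ^ l)"
  using assms
proof (induction l arbitrary: K)
  case (Suc l)
  have "core_count (m + l) (\<lambda>i. K i div 3) = core_count m (\<lambda>i. K i div 3 div 3 ^ l)"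
    using Suc by auto
  also have "(\<lambda>i. K i div 3 div 3 ^ l) = (\<lambda>i. K i div 3 ^ Suc l)"
    by (simp add: zdiv_zmult2_eq)
  finally show ?case
    using Suc.prems by auto
qed simp

definition cell :: "nat \<Rightarrow> real ^ 'n \<Rightarrow> 'n \<Rightarrow> int" where
  "cell m x i = \<lfloor>3 ^ m * x $ i\<rfloor>"

definition core_level :: "nat \<Rightarrow> real ^ 'n \<Rightarrow> nat" where
  "core_level m x = core_count m (cell m x)"

text \<open>At the coarse levels \<open>m < 0\<close> the truncation \<open>nat m = 0\<close> leaves the weight \<open>2^(-m)\<close>.\<close>

definition weight :: "nat \<Rightarrow> int \<Rightarrow> real ^ 'n \<Rightarrow> real" where
  "weight e m x = 2 powi (- (m + int e * int (core_level (nat m) x)))"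

lemma cell_Suc_div: "cell (Suc m) x i div 3 = cell m x i"
  unfolding cell_def by (rule floor_power_3_Suc)

lemma core_level_0 [simp]: "core_level 0 x = 0"
  by (simp add: core_level_def)

lemma core_level_Suc:
  "core_level (Suc m) x = core_level m x + (if \<forall>i. cell (Suc m) x i mod 3 = 1 then 1 else 0)"
proof -
  have "(\<lambda>i. cell (Suc m) x i div 3) = cell m x"
    by (simp add: cell_Suc_div fun_eq_iff)
  then show ?thesis
    by (simp add: core_level_def)
qed

lemma core_level_mono: "m \<le> m' \<Longrightarrow> core_level m x \<le> core_level m' x"
  by (induction m' rule: dec_induct) (auto simp: core_level_Suc)

lemma core_level_growth: "m \<le> m' \<Longrightarrow> core_level m' x \<le> core_level m x + (m' - m)"
  by (induction m' rule: dec_induct) (auto simp: core_level_Suc)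

lemma weight_pos: "0 < weight e m x"
  by (simp add: weight_def)

text \<open>Each level contributes a factor 1/2, and middle subcubes only decrease the weight
  further.\<close>

lemma weight_decay:
  assumes "m \<le> m'"
  shows "weight e m' x \<le> 2 powi (m - m') * weight e m x"
proof -
  have "int e * int (core_level (nat m) x) \<le> int e * int (core_level (nat m') x)"
    using assms by (intro mult_left_mono) (auto intro: core_level_mono)
  then show ?thesis
    unfolding weight_def by (subst power_int_add[symmetric]) (auto intro!: power_int_increasing)
qed

lemma weight_antimono:
  assumes "m \<le> m'"
  shows "weight e m' x \<le> weight e m x"
proof -
  have "2 powi (m - m') * weight e m x \<le> 1 * weight e m x"
    using assms weight_pos[of e m x] power_int_increasing[of "m - m'" 0 "2::real"]
    by (intro mult_right_mono) auto
  with weight_decay[OF assms, of e x] show ?thesis by simp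
qed

text \<open>One level adds at most one middle subcube and so costs at most a factor
  \<open>2^(e + 1)\<close>.\<close>

lemma weight_growth:
  assumes "m \<le> m'"
  shows "weight e m x \<le> 2 powi (int (Suc e) * (m' - m)) * weight e m' x"
proof -
  have "int (core_level (nat m') x) \<le> int (core_level (nat m) x) + (m' - m)"
    using core_level_growth[of "nat m" "nat m'" x] assms by linarith
  then have "int e * int (core_level (nat m') x) \<le> int e * (int (core_level (nat m) x) + (m' - m))"
    by (intro mult_left_mono) auto
  then show ?thesis
    unfolding weight_def
    by (subst power_int_add[symmetric]) (auto intro!: power_int_increasing simp: algebra_simps)
qed

text \<open>\<open>3 * 3^(-m)\<close> is the side length at level \<open>m - 1\<close>. There the
  cubes of \<open>x\<close> and \<open>y\<close> coincide or are adjacent, so their counts differ by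
  at most 1, and the step to level \<open>m\<close> adds at most 1 more. For
  \<open>m \<le> 0\<close> both counts vanish.\<close>

lemma weight_near:
  assumes "\<And>i. \<bar>x $ i - y $ i\<bar> \<le> 3 * 3 powi (- m)"
  shows "weight e m x \<le> 2 ^ (2 * e) * weight e m y"
proof -
  have "core_level (nat m) y \<le> core_level (nat m) x + 2"
  proof (cases "nat m")
    case (Suc k)
    then have m: "m = int k + 1" by simp
    have "\<bar>cell k y i - cell k x i\<bar> \<le> 1" for i
    proof -
      have "3 * 3 powi (- m) = (1 / 3 ^ k :: real)"
        by (simp add: m power_int_minus power_int_diff power_int_add field_simps)
      with assms[of i] have "\<bar>x $ i - y $ i\<bar> \<le> 1 / 3 ^ k"
        by simp
      then have "3 ^ k * \<bar>x $ i - y $ i\<bar> \<le> 1"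
        by (simp add: field_simps)
      moreover have "3 ^ k * \<bar>x $ i - y $ i\<bar> = \<bar>3 ^ k * x $ i - 3 ^ k * y $ i\<bar>"
        by (simp add: abs_mult flip: right_diff_distrib)
      ultimately have "\<bar>3 ^ k * x $ i - 3 ^ k * y $ i\<bar> \<le> 1"
        by simp
      then show ?thesis
        unfolding cell_def by linarith
    qed
    then have "core_level k y \<le> core_level k x + 1"
      unfolding core_level_def by (rule core_count_adjacent)
    then show ?thesis
      by (simp add: Suc core_level_Suc)
  qed simp
  then have "int e * int (core_level (nat m) y) \<le> int e * (int (core_level (nat m) x) + 2)"
    by (intro mult_left_mono) auto
  then have "- (m + int e * int (core_level (nat m) x))
      \<le> int (2 * e) + - (m + int e * int (core_level (nat m) y))"
    by (simp add: algebra_simps)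
  then have "weight e m x \<le> 2 powi (int (2 * e) + - (m + int e * int (core_level (nat m) y)))"
    unfolding weight_def by (intro power_int_increasing) auto
  also have "\<dots> = 2 ^ (2 * e) * weight e m y"
    unfolding weight_def power_int_add[OF disjI1, OF numeral_neq_zero] power_int_of_nat ..
  finally show ?thesis .
qed

text \<open>This makes the Cantor function of one coordinate admissible: if the digits
  \<open>m + 1, \<dots>, m + l\<close> of that coordinate avoid \<open>1\<close>, then none of the cubes of these levels around \<open>x\<close>
  is a middle subcube.\<close>

lemma weight_cantor_mass:
  "weight e m x * cantor_mass l (3 powi m * x $ i) \<le> weight e (m + int l) x"
proof (cases "cantor_free l \<lfloor>3 ^ l * (3 powi m * x $ i)\<rfloor>")
  case True
  have "core_level (nat (m + int l)) x = core_level (nat m) x"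
  proof (cases "0 \<le> m")
    case m: True
    define k where "k = nat m"
    have mk: "m = int k" using m by (simp add: k_def)
    have "cell (k + l) x i = \<lfloor>3 ^ l * (3 powi m * x $ i)\<rfloor>"
      by (simp add: cell_def mk power_add mult_ac)
    with True have "cantor_free l (cell (k + l) x i)" by simp
    then have "core_count (k + l) (cell (k + l) x) = core_count k (\<lambda>i. cell (k + l) x i div 3 ^ l)"
      by (rule core_count_add)
    also have "(\<lambda>i. cell (k + l) x i div 3 ^ l) = cell k x"
    proof
      fix i show "cell (k + l) x i div 3 ^ l = cell k x i"
        using floor_divide_real_eq_div[of "3 ^ l" "3 ^ (k + l) * x $ i"]
        by (simp add: cell_def power_add)
    qed
    finally show ?thesis
      by (simp add: core_level_def mk nat_int_add)
  next
    \<comment> \<open>For \<open>m < 0\<close> the level \<open>m + l\<close> is below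
      \<open>l\<close>, so every digit that counts is among those known to avoid 1.\<close>
    case m: False
    show ?thesis
    proof (cases "0 \<le> m + int l")
      case ml: True
      define k where "k = nat (m + int l)"
      have mk: "m = int k - int l" using ml by (simp add: k_def)
      have "cell k x i = \<lfloor>3 ^ l * (3 powi m * x $ i)\<rfloor>"
        by (simp add: cell_def mk power_int_diff)
      with True have "cantor_free l (cell k x i)" by simp
      then have "core_level k x = 0"
        unfolding core_level_def using m mk by (intro core_count_eq_0) auto
      then show ?thesis using m by (simp add: k_def)
    qed (use m in simp)
  qed
  then have "weight e (m + int l) x = weight e m x * 2 powi (- int l)"
    unfolding weight_def by (subst power_int_add[symmetric]) (auto simp: algebra_simps)
  then show ?thesis
    using True by (simp add: cantor_mass_def power_int_minus field_simps)
qed (use weight_pos[of e "m + int l" x] in \<open>simp add: cantor_mass_def\<close>)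

section \<open>A metric with prescribed diameters of cubes\<close>

definition admissible :: "nat \<Rightarrow> (real ^ 'n \<Rightarrow> real) set" where
  "admissible e = {u. \<forall>m x y. dist x y \<le> 3 powi (- m) \<longrightarrow> \<bar>u x - u y\<bar> \<le> weight e m x + weight e m y}"

text \<open>The largest pseudometric that is at most \<open>weight e m x + weight e m y\<close>
  whenever \<open>dist x y \<le> 3^(-m)\<close>. As a supremum of differences it satisfies the
  triangle inequality at once; the work lies in bounding it from below.\<close>

definition weight_dist :: "nat \<Rightarrow> real ^ 'n \<Rightarrow> real ^ 'n \<Rightarrow> real" where
  "weight_dist e x y = (SUP u\<in>admissible e. \<bar>u x - u y\<bar>)"

lemma triadic_scale:
  fixes r :: real
  assumes "0 < r"
  obtains m :: int where "3 powi (- m - 1) < r" "r \<le> 3 powi (- m)"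
proof
  define m where "m = - \<lceil>log 3 r\<rceil>"
  have "r = 3 powr log 3 r"
    using assms by simp
  moreover have "real_of_int (- m - 1) < log 3 r" "log 3 r \<le> real_of_int (- m)"
    unfolding m_def by linarith+
  ultimately have "3 powr real_of_int (- m - 1) < r" "r \<le> 3 powr real_of_int (- m)"
    by (metis powr_less_cancel_iff one_less_numeral_iff semiring_norm(77),
        metis powr_le_cancel_iff one_less_numeral_iff semiring_norm(77))
  then show "3 powi (- m - 1) < r" "r \<le> 3 powi (- m)"
    by (simp_all flip: powr_real_of_int')
qed

lemma admissible_zero: "(\<lambda>_. 0) \<in> admissible e"
  by (auto simp: admissible_def intro!: add_nonneg_nonneg less_imp_le[OF weight_pos])

lemma weight_dist_le:
  assumes "dist x y \<le> 3 powi (- m)"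
  shows "weight_dist e x y \<le> weight e m x + weight e m y"
  unfolding weight_dist_def
proof (rule cSUP_least)
  show "admissible e \<noteq> {}"
    using admissible_zero by blast
qed (use assms in \<open>auto simp: admissible_def\<close>)

lemma weight_dist_ge:
  assumes "u \<in> admissible e"
  shows "\<bar>u x - u y\<bar> \<le> weight_dist e x y"
proof -
  \<comment> \<open>Any scale above the distance bounds the differences of all admissible functions,
    so the supremum is taken over a bounded set.\<close>
  obtain m where m: "dist x y \<le> 3 powi (- m)"
  proof (cases "x = y")
    case True
    then show ?thesis using that[of 0] by simp
  next
    case False
    then show ?thesis using that triadic_scale[of "dist x y"] by (metis zero_less_dist_iff)
  qed
  have "bdd_above ((\<lambda>u. \<bar>u x - u y\<bar>) ` admissible e)"
    using m by (intro bdd_aboveI2[where M = "weight e m x + weight e m y"]) (auto simp: admissible_def)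
  then show ?thesis
    unfolding weight_dist_def using assms by (intro cSUP_upper) auto
qed

text \<open>The bump varies only near \<open>x\<close>, where the weights at level \<open>m\<close> are comparable to that of \<open>x\<close>.\<close>

lemma bump_admissible:
  fixes x :: "real ^ 'n" and m :: int
  defines "s \<equiv> \<lambda>z. \<Sum>i\<in>UNIV. \<bar>cantor_fun (3 powi m * z $ i) - cantor_fun (3 powi m * x $ i)\<bar>"
  shows "(\<lambda>z. weight e m x / (2 ^ (2 * e) * CARD('n)) * min 1 (s z)) \<in> admissible e"
proof -
  define c where "c = weight e m x / (2 ^ (2 * e) * CARD('n))"
  have c: "0 < c"
    by (simp add: c_def weight_pos)
  have s0: "0 \<le> s z" for z
    by (simp add: s_def sum_nonneg)
  \<comment> \<open>Where \<open>s \<ge> 1\<close> the bump has the constant value \<open>c\<close>,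
    so by symmetry \<open>s < 1\<close> may be assumed at one of the two points.\<close>
  have main: "\<bar>c * min 1 (s a) - c * min 1 (s b)\<bar> \<le> weight e j a + weight e j b"
    if "s a < 1" and ab: "dist a b \<le> 3 powi (- j)" for a b j
  proof -
    have near: "\<bar>x $ i - a $ i\<bar> < 2 * 3 powi (- m)" for i
    proof (rule ccontr)
      assume "\<not> ?thesis"
      then have "2 * 3 powi (- m) * 3 powi m \<le> \<bar>x $ i - a $ i\<bar> * 3 powi m"
        by (intro mult_right_mono) auto
      moreover have "\<bar>x $ i - a $ i\<bar> * 3 powi m = \<bar>3 powi m * a $ i - 3 powi m * x $ i\<bar>"
        by (simp add: abs_mult abs_minus_commute flip: right_diff_distrib)
      moreover have "2 * 3 powi (- m) * 3 powi m = (2::real)"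
        by (simp add: power_int_minus)
      ultimately have "1 \<le> \<bar>cantor_fun (3 powi m * a $ i) - cantor_fun (3 powi m * x $ i)\<bar>"
        by (intro cantor_fun_separates) linarith
      also have "\<dots> \<le> s a"
        unfolding s_def by (rule member_le_sum) auto
      finally show False using \<open>s a < 1\<close> by simp
    qed
    \<comment> \<open>The factor \<open>2^(2 e)\<close> in \<open>c\<close> pays for
      \<open>weight_near\<close>. The range 3 instead of 2 leaves room for \<open>b\<close>, which
      is within \<open>3^(-m)\<close> of \<open>a\<close> if \<open>j > m\<close>.\<close>
    have cw: "c \<le> weight e m y / CARD('n)" if "\<And>i. \<bar>x $ i - y $ i\<bar> \<le> 3 * 3 powi (- m)" for y
    proof -
      have "c \<le> 2 ^ (2 * e) * weight e m y / (2 ^ (2 * e) * CARD('n))"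
        unfolding c_def by (intro divide_right_mono weight_near that) auto
      then show ?thesis by simp
    qed
    have pos3: "(0::real) < 3 powi (- m)" by simp
    have ca: "c \<le> weight e m a / CARD('n)"
    proof (rule cw)
      show "\<bar>x $ i - a $ i\<bar> \<le> 3 * 3 powi (- m)" for i
        using near[of i] pos3 by linarith
    qed
    have diff: "\<bar>c * min 1 (s a) - c * min 1 (s b)\<bar> = c * \<bar>min 1 (s a) - min 1 (s b)\<bar>"
      using c by (simp add: abs_mult flip: right_diff_distrib)
    \<comment> \<open>For \<open>j \<le> m\<close> the full height \<open>c\<close> of the bump is
      already below the weight of \<open>a\<close>. For finer scales the small variation of the
      Cantor functions over \<open>l = j - m\<close> further levels is used.\<close>
    show ?thesis
    proof (cases "j \<le> m")
      case True
      have "c * \<bar>min 1 (s a) - min 1 (s b)\<bar> \<le> c * 1"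
        using c s0[of a] s0[of b] by (intro mult_left_mono) auto
      also have "c * 1 \<le> weight e m a / real CARD('n)"
        using ca by simp
      also have "\<dots> \<le> weight e m a / 1"
        using weight_pos[of e m a] by (intro divide_left_mono) (auto simp: Suc_le_eq)
      also have "\<dots> \<le> weight e j a"
        using weight_antimono[OF True] by simp
      finally show ?thesis
        using diff weight_pos[of e j b] by simp
    next
      case False
      define l where "l = nat (j - m)"
      have j: "j = m + int l"
        using False by (simp add: l_def)
      have abi: "\<bar>a $ i - b $ i\<bar> \<le> 3 powi (- j)" for i
        using ab component_le_norm_cart[of "a - b" i] by (simp add: dist_norm)
      have "3 powi (- j) \<le> (3::real) powi (- m)"
        using False by (intro power_int_increasing) auto
      then have "\<bar>x $ i - b $ i\<bar> \<le> 3 * 3 powi (- m)" for i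
        using near[of i] abi[of i] by linarith
      then have cb: "c \<le> weight e m b / CARD('n)"
        by (rule cw)
      have "\<bar>min 1 (s a) - min 1 (s b)\<bar> \<le> \<bar>s a - s b\<bar>"
        by linarith
      also have "\<dots> \<le> (\<Sum>i\<in>UNIV. \<bar>cantor_fun (3 powi m * a $ i) - cantor_fun (3 powi m * b $ i)\<bar>)"
        unfolding s_def sum_subtractf[symmetric]
        by (rule order.trans[OF sum_abs]) (rule sum_mono, linarith)
      also have "\<dots> \<le> (\<Sum>i\<in>UNIV. cantor_mass l (3 powi m * a $ i) + cantor_mass l (3 powi m * b $ i))"
      proof (intro sum_mono cantor_fun_diff_le)
        fix i
        have "\<bar>3 powi m * a $ i - 3 powi m * b $ i\<bar> = 3 powi m * \<bar>a $ i - b $ i\<bar>"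
          by (simp add: abs_mult flip: right_diff_distrib)
        also have "\<dots> \<le> 3 powi m * 3 powi (- j)"
          using abi by (intro mult_left_mono) auto
        also have "\<dots> = 1 / 3 ^ l"
          by (simp add: j power_int_minus power_int_diff)
        finally show "\<bar>3 powi m * a $ i - 3 powi m * b $ i\<bar> \<le> 1 / 3 ^ l" .
      qed
      finally have "c * \<bar>min 1 (s a) - min 1 (s b)\<bar>
          \<le> c * (\<Sum>i\<in>UNIV. cantor_mass l (3 powi m * a $ i) + cantor_mass l (3 powi m * b $ i))"
        using c by (intro mult_left_mono) auto
      also have "\<dots> = (\<Sum>i\<in>UNIV. c * cantor_mass l (3 powi m * a $ i) + c * cantor_mass l (3 powi m * b $ i))"
        by (simp add: sum_distrib_left distrib_left)
      \<comment> \<open>By \<open>weight_cantor_mass\<close> the mass turns a weight of level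
        \<open>m\<close> into one of level \<open>j\<close>; the divisor \<open>CARD('n)\<close> in
        \<open>c\<close> absorbs the sum over the coordinates.\<close>
      also have "\<dots> \<le> (\<Sum>i\<in>(UNIV::'n set). (weight e j a + weight e j b) / CARD('n))"
      proof (intro sum_mono)
        fix i
        have "c * cantor_mass l (3 powi m * a $ i) \<le> weight e m a / CARD('n) * cantor_mass l (3 powi m * a $ i)"
          "c * cantor_mass l (3 powi m * b $ i) \<le> weight e m b / CARD('n) * cantor_mass l (3 powi m * b $ i)"
          by (intro mult_right_mono ca cb cantor_mass_nonneg)+
        moreover have "weight e m y / CARD('n) * cantor_mass l (3 powi m * y $ i) \<le> weight e j y / CARD('n)" for y :: "real ^ 'n"
          using weight_cantor_mass[of e m y l i] by (simp add: j divide_right_mono)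
        ultimately show "c * cantor_mass l (3 powi m * a $ i) + c * cantor_mass l (3 powi m * b $ i)
            \<le> (weight e j a + weight e j b) / CARD('n)"
          unfolding add_divide_distrib by (meson add_mono order_trans)
      qed
      also have "\<dots> = weight e j a + weight e j b"
        by simp
      finally show ?thesis
        using diff by simp
    qed
  qed
  show ?thesis
    unfolding admissible_def c_def[symmetric]
  proof (intro CollectI allI impI)
    fix j :: int and a b :: "real ^ 'n"
    assume ab: "dist a b \<le> 3 powi (- j)"
    show "\<bar>c * min 1 (s a) - c * min 1 (s b)\<bar> \<le> weight e j a + weight e j b"
    proof (cases "s a < 1 \<or> s b < 1")
      case True
      then show ?thesis
        using main[of a b j] main[of b a j] ab by (auto simp: dist_commute abs_minus_commute add.commute)
    qed (use weight_pos[of e j a] weight_pos[of e j b] in auto)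
  qed
qed

text \<open>The bump of a level \<open>m + r\<close> centred at \<open>x\<close> vanishes at
  \<open>x\<close> and has full height at \<open>y\<close>. Descending a fixed number
  \<open>r\<close> of levels costs only a constant factor.\<close>

lemma weight_dist_lower:
  "\<exists>c>0. \<forall>m (x :: real ^ 'n) y. 3 powi (- m) \<le> dist x y \<longrightarrow> c * weight e m x \<le> weight_dist e x y"
proof -
  \<comment> \<open>With this \<open>r\<close>, coordinate differences all below
    \<open>2 * 3^(-m')\<close> cannot add up to \<open>3^(-m)\<close>, so
    \<open>cantor_fun_separates\<close> applies to some coordinate.\<close>
  obtain r where r: "2 * real CARD('n) < 3 ^ r"
    using real_arch_pow[of 3 "2 * real CARD('n)"] by auto
  define c :: real where "c = 1 / (2 ^ (2 * e) * CARD('n) * 2 ^ (Suc e * r))"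
  have "c * weight e m x \<le> weight_dist e x y" if xy: "3 powi (- m) \<le> dist x y" for m and x y :: "real ^ 'n"
  proof -
    define m' where "m' = m + int r"
    define s where "s z = (\<Sum>i\<in>UNIV. \<bar>cantor_fun (3 powi m' * z $ i) - cantor_fun (3 powi m' * x $ i)\<bar>)" for z
    have "\<exists>i. 2 * 3 powi (- m') \<le> \<bar>y $ i - x $ i\<bar>"
    proof (rule ccontr)
      assume "\<not> ?thesis"
      then have "(\<Sum>i\<in>UNIV. \<bar>y $ i - x $ i\<bar>) \<le> (\<Sum>i\<in>(UNIV::'n set). 2 * 3 powi (- m'))"
        by (intro sum_mono) (auto simp: not_le less_imp_le)
      moreover have "dist x y \<le> (\<Sum>i\<in>UNIV. \<bar>y $ i - x $ i\<bar>)"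
        using norm_le_l1_cart[of "y - x"] by (simp add: dist_norm norm_minus_commute)
      ultimately have "3 powi (- m) \<le> CARD('n) * (2 * 3 powi (- m'))"
        using xy by simp
      moreover have "3 powi (- m) = 3 ^ r * (3 powi (- m') :: real)"
        by (simp add: m'_def power_int_diff)
      ultimately have "3 ^ r * 3 powi (- m') \<le> (2 * real CARD('n)) * 3 powi (- m')"
        by (simp add: mult_ac)
      then have "3 ^ r \<le> 2 * real CARD('n)"
        by (rule mult_right_le_imp_le) simp
      with r show False by simp
    qed
    then obtain i where i: "2 * 3 powi (- m') \<le> \<bar>y $ i - x $ i\<bar>" ..
    have "2 = 3 powi m' * (2 * 3 powi (- m') :: real)"
      by (simp add: power_int_minus)
    also have "\<dots> \<le> 3 powi m' * \<bar>y $ i - x $ i\<bar>"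
      using i by (intro mult_left_mono) auto
    also have "\<dots> = \<bar>3 powi m' * y $ i - 3 powi m' * x $ i\<bar>"
      by (simp add: abs_mult flip: right_diff_distrib)
    finally have "1 \<le> \<bar>cantor_fun (3 powi m' * y $ i) - cantor_fun (3 powi m' * x $ i)\<bar>"
      by (rule cantor_fun_separates)
    also have "\<dots> \<le> s y"
      unfolding s_def by (rule member_le_sum) auto
    finally have sy: "min 1 (s y) = 1" by simp
    have sx: "min 1 (s x) = 0" by (simp add: s_def)
    have "weight e m x \<le> 2 powi (int (Suc e) * (m' - m)) * weight e m' x"
      by (rule weight_growth) (simp add: m'_def)
    also have "2 powi (int (Suc e) * (m' - m)) = (2 ^ (Suc e * r) :: real)"
      by (simp add: m'_def flip: of_nat_mult of_nat_Suc power_int_of_nat)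
    finally have "c * weight e m x \<le> c * (2 ^ (Suc e * r) * weight e m' x)"
      by (intro mult_left_mono) (auto simp: c_def)
    also have "\<dots> = weight e m' x / (2 ^ (2 * e) * CARD('n))"
      by (simp add: c_def)
    also have "\<dots> \<le> weight_dist e x y"
      using weight_dist_ge[OF bump_admissible[of e m' x, folded s_def], of x y] weight_pos[of e m' x]
      by (simp add: sx sy)
    finally show ?thesis .
  qed
  moreover have "c > 0"
    by (simp add: c_def)
  ultimately show ?thesis by blast
qed

lemma Metric_space_weight_dist: "Metric_space UNIV (weight_dist e :: real ^ 'n \<Rightarrow> _)"
proof
  fix x y z :: "real ^ 'n"
  show "0 \<le> weight_dist e x y"
    using weight_dist_ge[OF admissible_zero, of _ x y] by simp
  show "weight_dist e x y = weight_dist e y x"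
    by (simp add: weight_dist_def abs_minus_commute)
  have "admissible e \<noteq> ({} :: (real ^ 'n \<Rightarrow> real) set)"
    using admissible_zero by blast
  moreover have "\<bar>u x - u z\<bar> \<le> weight_dist e x y + weight_dist e y z" if "u \<in> admissible e" for u
    using weight_dist_ge[OF that, of x y] weight_dist_ge[OF that, of y z] by linarith
  ultimately show "weight_dist e x z \<le> weight_dist e x y + weight_dist e y z"
    unfolding weight_dist_def[of e x z] by (rule cSUP_least)
  show "weight_dist e x y = 0 \<longleftrightarrow> x = y"
  proof
    assume 0: "weight_dist e x y = 0"
    show "x = y"
    proof (rule ccontr)
      assume "x \<noteq> y"
      then obtain m where "3 powi (- m - 1) < dist x y"
        by (metis triadic_scale zero_less_dist_iff)
      then have *: "3 powi (- (m + 1)) \<le> dist x y"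
        by simp
      obtain c where "c > 0" "c * weight e (m + 1) x \<le> weight_dist e x y"
        using weight_dist_lower[where 'n = 'n, of e] * by blast
      with 0 weight_pos[of e "m + 1" x] show False
        by (simp add: mult_le_0_iff)
    qed
  qed (simp add: weight_dist_def \<open>admissible e \<noteq> {}\<close>)
qed

definition weight_metric :: "nat \<Rightarrow> (real ^ 'n) metric" where
  "weight_metric e = metric (UNIV, weight_dist e)"

lemma weight_metric_simps [simp]:
  "mspace (weight_metric e) = UNIV" "mdist (weight_metric e) = weight_dist e"
  by (simp_all add: weight_metric_def Metric_space.mspace_metric Metric_space.mdist_metric
      Metric_space_weight_dist)

text \<open>Weights of level \<open>k\<close> are at most \<open>2^(-k)\<close>, which gives
  continuity in one direction; the contrapositive of \<open>weight_dist_lower\<close> gives the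
  other.\<close>

lemma homeomorphic_map_weight_metric:
  "homeomorphic_map euclidean (mtopology_of (weight_metric e :: (real ^ 'n) metric)) id"
proof -
  interpret W: Metric_space UNIV "weight_dist e :: real ^ 'n \<Rightarrow> _"
    by (rule Metric_space_weight_dist)
  have top: "mtopology_of (weight_metric e) = W.mtopology"
    by (simp add: weight_metric_def)
  have eucl: "(euclidean :: (real ^ 'n) topology) = Met_TC.mtopology"
    by simp
  have "continuous_map euclidean W.mtopology id"
    unfolding eucl Met_TC.metric_continuous_map[OF Metric_space_weight_dist]
  proof (intro conjI ballI allI impI)
    fix x :: "real ^ 'n" and \<epsilon> :: real
    assume "0 < \<epsilon>"
    then obtain k where k: "(1 / 2) ^ k < \<epsilon> / 2"
      using real_arch_pow_inv[of "\<epsilon> / 2" "1 / 2"] by auto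
    have w: "weight e k y \<le> (1 / 2) ^ k" for y :: "real ^ 'n"
      using weight_decay[of 0 "int k" e y] by (simp add: weight_def power_int_minus field_simps)
    show "\<exists>\<delta>>0. \<forall>y. y \<in> UNIV \<and> dist x y < \<delta> \<longrightarrow> weight_dist e (id x) (id y) < \<epsilon>"
    proof (intro exI[of _ "3 powi (- int k)"] conjI allI impI)
      fix y assume "y \<in> UNIV \<and> dist x y < 3 powi (- int k)"
      then have "weight_dist e x y \<le> weight e k x + weight e k y"
        by (intro weight_dist_le) simp
      with w[of x] w[of y] k show "weight_dist e (id x) (id y) < \<epsilon>"
        by simp
    qed simp
  qed simp
  moreover have "continuous_map W.mtopology euclidean id"
    unfolding eucl W.metric_continuous_map[OF Met_TC.Metric_space_axioms]
  proof (intro conjI ballI allI impI)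
    fix x :: "real ^ 'n" and \<epsilon> :: real
    assume "0 < \<epsilon>"
    then obtain m where m: "3 powi (- m - 1) < \<epsilon>"
      using triadic_scale by blast
    obtain c where c: "c > 0"
      "\<And>m (x :: real ^ 'n) y. 3 powi (- m) \<le> dist x y \<Longrightarrow> c * weight e m x \<le> weight_dist e x y"
      using weight_dist_lower[where 'n = 'n, of e] by blast
    show "\<exists>\<delta>>0. \<forall>y. y \<in> UNIV \<and> weight_dist e x y < \<delta> \<longrightarrow> dist (id x) (id y) < \<epsilon>"
    proof (intro exI[of _ "c * weight e (m + 1) x"] conjI allI impI)
      fix y assume "y \<in> UNIV \<and> weight_dist e x y < c * weight e (m + 1) x"
      then have "\<not> 3 powi (- (m + 1)) \<le> dist x y"
        using c(2)[of "m + 1" x y] by linarith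
      with m show "dist (id x) (id y) < \<epsilon>"
        by simp
    qed (simp add: c(1) weight_pos)
  qed simp
  ultimately have "homeomorphic_maps euclidean (mtopology_of (weight_metric e :: (real ^ 'n) metric)) id id"
    unfolding homeomorphic_maps_def top by simp
  then show ?thesis
    using homeomorphic_maps_map by blast
qed

section \<open>Quasisymmetry of the identity map\<close>

lemma homeomorphism_sqrt_plus_power:
  assumes "0 < D"
  shows "\<exists>\<theta>. homeomorphism {0..} {0..} (\<lambda>t. D * (sqrt (3 * t) + (3 * t) ^ Suc k)) \<theta>"
proof (rule homeomorphism_into_1d)
  let ?\<eta> = "\<lambda>t. D * (sqrt (3 * t) + (3 * t) ^ Suc k)"
  show "path_connected {0::real..}"
    by (intro convex_imp_path_connected convex_real_interval)
  show cont: "continuous_on {0..} ?\<eta>"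
    by (intro continuous_intros)
  have less: "?\<eta> s < ?\<eta> t" if "0 \<le> s" "s < t" for s t
    using that assms by (intro mult_strict_left_mono add_strict_mono power_strict_mono) auto
  show "inj_on ?\<eta> {0..}"
    by (rule linorder_inj_onI) (use less in \<open>force simp del: power_Suc\<close>)+
  show "?\<eta> ` {0..} = {0..}"
  proof
    show "?\<eta> ` {0..} \<subseteq> {0..}"
      using assms by auto
    show "{0..} \<subseteq> ?\<eta> ` {0..}"
    proof
      fix y :: real assume "y \<in> {0..}"
      then have y: "0 \<le> y" by simp
      \<comment> \<open>Then \<open>3 * T \<ge> 1\<close>, so the power dominates
        \<open>3 * T\<close>, and \<open>D * (3 * T) = D + y\<close>; hence the value
        \<open>y\<close> is attained between 0 and \<open>T\<close>.\<close>
      define T where "T = (1 + y / D) / 3"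
      have T: "1 \<le> 3 * T" "0 \<le> T" "y \<le> D * (3 * T)"
        using assms y by (auto simp: T_def field_simps)
      have "3 * T \<le> (3 * T) ^ Suc k"
        using T(1) by (intro self_le_power) auto
      then have "3 * T \<le> sqrt (3 * T) + (3 * T) ^ Suc k"
        using real_sqrt_ge_zero[of "3 * T"] T by linarith
      then have "y \<le> ?\<eta> T"
        using T(3) assms by (meson mult_left_mono less_imp_le order_trans)
      then obtain t where "0 \<le> t" "?\<eta> t = y"
        using IVT'[of ?\<eta> 0 y T] y T(2) continuous_on_subset[OF cont, of "{0..T}"] by auto
      then show "y \<in> ?\<eta> ` {0..}"
        by (intro image_eqI[of _ _ t]) auto
    qed
  qed
qed

text \<open>Let \<open>k\<close> be the distance of the levels. For \<open>m \<le> m'\<close> the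
  ratio is at most \<open>2^((e + 1) k)\<close>, and \<open>2^k \<le> 3^k \<le> t\<close>. Otherwise
  it is at most \<open>2^(-k)\<close>, and \<open>4^(-k) \<le> 3^(-k) \<le> t\<close> yields the
  square root.\<close>

lemma weight_ratio:
  assumes "3 powi (m' - m) \<le> t"
  shows "weight e m x \<le> (sqrt t + t ^ Suc e) * weight e m' x"
proof -
  have t: "0 < t"
    using assms by (rule less_le_trans[rotated]) simp
  show ?thesis
  proof (cases "m \<le> m'")
    case True
    define k where "k = nat (m' - m)"
    have k: "m' - m = int k"
      using True by (simp add: k_def)
    have "weight e m x \<le> 2 powi (int (Suc e) * int k) * weight e m' x"
      using weight_growth[OF True, of e x] by (simp only: k)
    also have "2 powi (int (Suc e) * int k) = ((2 ^ k) ^ Suc e :: real)"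
      by (simp only: of_nat_mult[symmetric] power_int_of_nat mult.commute[of "Suc e"] power_mult)
    also have "\<dots> \<le> t ^ Suc e"
      using assms power_mono[of "2::real" 3 k] by (intro power_mono) (auto simp: k)
    also have "\<dots> \<le> sqrt t + t ^ Suc e"
      using t by simp
    finally show ?thesis
      using weight_pos[of e m' x] by (simp add: mult_right_mono)
  next
    case False
    define k where "k = nat (m - m')"
    have k: "m' - m = - int k"
      using False by (simp add: k_def)
    have "((1 / 2) ^ k)\<^sup>2 = ((1 / 4) ^ k :: real)"
      by (simp add: power2_eq_square flip: power_mult_distrib)
    also have "\<dots> \<le> (1 / 3) ^ k"
      by (intro power_mono) auto
    also have "\<dots> \<le> t"
      using assms by (simp add: k power_int_minus power_divide field_simps)
    finally have "(1 / 2) ^ k \<le> sqrt t"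
      by (rule real_le_rsqrt)
    have "weight e m x \<le> 2 powi (m' - m) * weight e m' x"
      using False by (intro weight_decay) simp
    also have "2 powi (m' - m) = ((1 / 2) ^ k :: real)"
      by (simp add: k power_int_minus power_divide field_simps)
    also have "\<dots> \<le> sqrt t + t ^ Suc e"
      using \<open>(1 / 2) ^ k \<le> sqrt t\<close> t by (intro add_increasing2) auto
    finally show ?thesis
      using weight_pos[of e m' x] by (simp add: mult_right_mono)
  qed
qed

text \<open>The numerator is bounded above at the scale of \<open>dist x y\<close>, the denominator
  below at the scale of \<open>dist x z\<close>, and \<open>weight_ratio\<close> compares the two
  weights of the same point \<open>x\<close>.\<close>

lemma quasisymmetric_weight_metric:
  "quasisymmetric_map euclidean_metric (weight_metric e :: (real ^ 'n) metric) id"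
proof -
  obtain c where c: "c > 0"
    "\<And>m (x :: real ^ 'n) y. 3 powi (- m) \<le> dist x y \<Longrightarrow> c * weight e m x \<le> weight_dist e x y"
    using weight_dist_lower[where 'n = 'n, of e] by blast
  \<comment> \<open>The factors come from replacing the weight of \<open>y\<close> by that of
    \<open>x\<close>, from passing to level \<open>m' + 1\<close>, where the lower bound applies,
    and from the constant of that bound.\<close>
  define D where "D = (1 + 2 ^ (2 * e)) * 2 ^ Suc e / c"
  have D: "0 < D"
    using c(1) by (simp add: D_def add_pos_pos)
  have ratio: "weight_dist e x y / weight_dist e x z
      \<le> D * (sqrt (3 * (dist x y / dist x z)) + (3 * (dist x y / dist x z)) ^ Suc e)"
    if "x \<noteq> y" "x \<noteq> z" for x y z :: "real ^ 'n"
  proof -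
    obtain m where m: "3 powi (- m - 1) < dist x y" "dist x y \<le> 3 powi (- m)"
      using \<open>x \<noteq> y\<close> by (metis triadic_scale zero_less_dist_iff)
    obtain m' where m': "3 powi (- m' - 1) < dist x z" "dist x z \<le> 3 powi (- m')"
      using \<open>x \<noteq> z\<close> by (metis triadic_scale zero_less_dist_iff)
    define t where "t = 3 * (dist x y / dist x z)"
    \<comment> \<open>Rounding the two distances to powers of 3 accounts for the factor 3 in
      \<open>t\<close>.\<close>
    have "3 powi (m' - m) = 3 * (3 powi (- m - 1) / 3 powi (- m') :: real)"
      by (simp add: power_int_diff power_int_minus field_simps)
    also have "\<dots> \<le> t"
      unfolding t_def using m m' \<open>x \<noteq> z\<close> by (intro mult_left_mono frac_le) auto
    finally have t: "3 powi (m' - m) \<le> t" .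
    have t0: "0 \<le> t"
      by (simp add: t_def)
    have "\<bar>y $ i - x $ i\<bar> \<le> 3 * 3 powi (- m)" for i
      using component_le_norm_cart[of "y - x" i] m(2) zero_le_dist[of x y]
      unfolding dist_norm norm_minus_commute[of x y] by simp
    then have "weight e m y \<le> 2 ^ (2 * e) * weight e m x"
      by (rule weight_near)
    then have "weight_dist e x y \<le> (1 + 2 ^ (2 * e)) * weight e m x"
      using weight_dist_le[OF m(2), of e] by (simp add: algebra_simps)
    moreover have "weight e m x \<le> (sqrt t + t ^ Suc e) * (2 ^ Suc e * (weight_dist e x z / c))"
    proof -
      have "weight e m' x \<le> 2 ^ Suc e * weight e (m' + 1) x"
        using weight_growth[of m' "m' + 1" e x] by (simp only: power_int_of_nat add_diff_cancel_left' mult_1_right)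
      also have "\<dots> \<le> 2 ^ Suc e * (weight_dist e x z / c)"
      proof -
        have "3 powi (- (m' + 1)) \<le> dist x z"
          using m'(1) by simp
        from c(2)[OF this] c(1) show ?thesis
          by (intro mult_left_mono) (auto simp: field_simps)
      qed
      finally have "(sqrt t + t ^ Suc e) * weight e m' x
          \<le> (sqrt t + t ^ Suc e) * (2 ^ Suc e * (weight_dist e x z / c))"
        using t0 by (intro mult_left_mono) auto
      with weight_ratio[OF t, of e x] show ?thesis
        by (rule order_trans)
    qed
    then have "(1 + 2 ^ (2 * e)) * weight e m x
        \<le> (1 + 2 ^ (2 * e)) * ((sqrt t + t ^ Suc e) * (2 ^ Suc e * (weight_dist e x z / c)))"
      by (intro mult_left_mono) (auto simp: add_nonneg_nonneg)
    ultimately have "weight_dist e x y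
        \<le> (1 + 2 ^ (2 * e)) * ((sqrt t + t ^ Suc e) * (2 ^ Suc e * (weight_dist e x z / c)))"
      by (rule order_trans)
    then have "weight_dist e x y \<le> D * (sqrt t + t ^ Suc e) * weight_dist e x z"
      by (simp add: D_def mult_ac)
    moreover have "0 < weight_dist e x z"
      using Metric_space.mdist_pos_less[OF Metric_space_weight_dist \<open>x \<noteq> z\<close>] by simp
    ultimately show ?thesis
      unfolding t_def[symmetric] by (simp add: divide_le_eq)
  qed
  obtain \<theta> where \<theta>: "homeomorphism {0..} {0..} (\<lambda>t. D * (sqrt (3 * t) + (3 * t) ^ Suc e)) \<theta>"
    using homeomorphism_sqrt_plus_power[OF D, of e] by blast
  show ?thesis
    unfolding quasisymmetric_map_def mtopology_of_euclidean mspace_euclidean_metric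
      mdist_euclidean_metric weight_metric_simps
    by (intro conjI exI ballI impI, rule homeomorphic_map_weight_metric, rule \<theta>)
       (unfold id_apply, elim conjE, rule ratio)
qed

section \<open>Points in many middle subcubes\<close>

primrec subcells :: "nat \<Rightarrow> ('n \<Rightarrow> int) \<Rightarrow> ('n \<Rightarrow> int) set" where
  "subcells 0 v = {v}"
| "subcells (Suc m) v = {K. (\<lambda>i. K i div 3) \<in> subcells m v}"

lemma cell_in_subcells: "cell m x \<in> subcells m v \<longleftrightarrow> cell 0 x = v"
proof (induction m)
  case (Suc m)
  have "(\<lambda>i. cell (Suc m) x i div 3) = cell m x"
    by (simp add: cell_Suc_div fun_eq_iff)
  with Suc show ?case by simp
qed simp

text \<open>A cube of level \<open>m + 1\<close> amounts to its parent together with its vector of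
  last digits.\<close>

lemma subcells_bij:
  "bij_betw (\<lambda>(K, r) i. 3 * K i + r i) (subcells m v \<times> (UNIV \<rightarrow> {0, 1, 2})) (subcells (Suc m) v)"
proof (rule bij_betwI[where g = "\<lambda>K. (\<lambda>i. K i div 3, \<lambda>i. K i mod 3)"])
  have *: "(3 * k + r) div 3 = k" "(3 * k + r) mod 3 = r" if "r \<in> {0, 1, 2}" for k r :: int
    using that by auto
  have digits: "r i \<in> {0, 1, 2}" if "r \<in> UNIV \<rightarrow> {0, 1, 2::int}" for r and i :: 'a
    using that by (rule funcset_mem) simp
  show "(\<lambda>(K, r) i. 3 * K i + r i) \<in> subcells m v \<times> (UNIV \<rightarrow> {0, 1, 2}) \<rightarrow> subcells (Suc m) v"
    by (auto simp only: subcells.simps *(1)[OF digits])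
  show "(\<lambda>K. (\<lambda>i. K i div 3, \<lambda>i. K i mod 3)) \<in> subcells (Suc m) v \<rightarrow> subcells m v \<times> (UNIV \<rightarrow> {0, 1, 2})"
    by auto
  show "(\<lambda>i. (case p of (K, r) \<Rightarrow> \<lambda>i. 3 * K i + r i) i div 3,
         \<lambda>i. (case p of (K, r) \<Rightarrow> \<lambda>i. 3 * K i + r i) i mod 3) = p"
    if "p \<in> subcells m v \<times> (UNIV \<rightarrow> {0, 1, 2})" for p
    using that by (auto simp only: * digits fun_eq_iff split: prod.splits)
qed auto

text \<open>Among the \<open>3^CARD('n)\<close> digit vectors of a child exactly one, the constant
  1, contributes \<open>z\<close>, and the others contribute 1. So each level multiplies the
  generating function by the same factor.\<close>

lemma
  fixes v :: "'n::finite \<Rightarrow> int"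
  shows finite_subcells: "finite (subcells m v)"
    and sum_core_count: "(\<Sum>K\<in>subcells m v. z ^ core_count m K) = (3 ^ CARD('n) - 1 + z :: real) ^ m"
proof (induction m)
  case (Suc m)
  let ?R = "UNIV \<rightarrow> {0, 1, 2} :: ('n \<Rightarrow> int) set"
  have PiE: "?R = PiE UNIV (\<lambda>_. {0, 1, 2})"
    by (simp add: PiE_def)
  have R: "finite ?R" "card ?R = 3 ^ CARD('n)"
    unfolding PiE by (simp_all add: finite_PiE card_PiE numeral_3_eq_3)
  {
    case 1
    show ?case
      using bij_betw_finite[OF subcells_bij[of m v]] Suc(1) R(1) by (simp del: subcells.simps)
  next
    case 2
    let ?c = "\<lambda>r :: 'n \<Rightarrow> int. if \<forall>i. r i = 1 then 1 else 0 :: nat"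
    have "core_count (Suc m) (\<lambda>i. 3 * K i + r i) = core_count m K + ?c r" if "r \<in> ?R" for K r
    proof -
      have "(3 * K i + r i) div 3 = K i" "(3 * K i + r i) mod 3 = r i" for i
        using funcset_mem[OF that, of i] by auto
      then show ?thesis by simp
    qed
    then have "(\<Sum>K\<in>subcells (Suc m) v. z ^ core_count (Suc m) K)
        = (\<Sum>(K, r)\<in>subcells m v \<times> ?R. z ^ core_count m K * z ^ ?c r)"
      by (subst sum.reindex_bij_betw[OF subcells_bij, symmetric])
         (auto intro!: sum.cong simp: power_add simp del: core_count.simps)
    also have "\<dots> = (\<Sum>K\<in>subcells m v. z ^ core_count m K) * (\<Sum>r\<in>?R. z ^ ?c r)"
      by (simp add: sum_product sum.cartesian_product)
    also have "(\<Sum>r\<in>?R. z ^ ?c r) = 3 ^ CARD('n) - 1 + z"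
    proof -
      have "(\<Sum>r\<in>?R. z ^ ?c r) = z + (\<Sum>r\<in>?R - {\<lambda>_. 1}. z ^ ?c r)"
        using R(1) by (subst sum.remove[of _ "\<lambda>_. 1"]) auto
      also have "(\<Sum>r\<in>?R - {\<lambda>_. 1}. z ^ ?c r) = (\<Sum>r\<in>?R - {\<lambda>_. 1}. 1)"
        by (intro sum.cong) (auto simp: fun_eq_iff)
      also have "\<dots> = 3 ^ CARD('n) - 1"
        using R by (simp add: card_Diff_singleton of_nat_diff)
      finally show ?thesis by simp
    qed
    finally show ?case
      using Suc(2) by (simp add: mult.commute)
  }
qed auto

lemma card_subcells: "card (subcells m (v :: 'n::finite \<Rightarrow> int)) = (3 ^ CARD('n)) ^ m"
  using sum_core_count[where z = 1 and m = m and v = v] by (simp flip: of_nat_eq_iff[where 'a = real])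

text \<open>Markov's inequality for the generating function at \<open>z = 1/2\<close>.\<close>

lemma card_sparse_subcells:
  fixes v :: "'n::finite \<Rightarrow> int"
  assumes "0 < \<tau>"
  shows "card {K \<in> subcells m v. \<tau> ^ m \<le> (1 / 2) ^ core_count m K}
    \<le> ((3 ^ CARD('n) - 1 / 2) / \<tau> :: real) ^ m"
proof -
  let ?B = "{K \<in> subcells m v. \<tau> ^ m \<le> (1 / 2) ^ core_count m K}"
  have "\<tau> ^ m * card ?B = (\<Sum>K\<in>?B. \<tau> ^ m)"
    by simp
  also have "\<dots> \<le> (\<Sum>K\<in>?B. (1 / 2) ^ core_count m K)"
    by (intro sum_mono) simp
  also have "\<dots> \<le> (\<Sum>K\<in>subcells m v. (1 / 2) ^ core_count m K)"
    by (intro sum_mono2 finite_subcells) auto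
  also have "\<dots> = (3 ^ CARD('n) - 1 / 2) ^ m"
    by (simp add: sum_core_count)
  finally show ?thesis
    using assms by (simp add: power_divide field_simps)
qed

section \<open>Almost every point is good\<close>

lemma cell_measurable [measurable]:
  "(cell m :: real ^ 'n \<Rightarrow> 'n \<Rightarrow> int) \<in> borel \<rightarrow>\<^sub>M count_space UNIV"
proof -
  have "cell m -` {K} \<inter> space borel \<in> sets (borel :: (real ^ 'n) measure)" for K :: "'n \<Rightarrow> int"
  proof -
    have "{x :: real ^ 'n. \<forall>i. cell m x i = K i} \<in> sets borel"
      unfolding cell_def by measurable
    then show ?thesis
      by (simp add: vimage_def fun_eq_iff)
  qed
  then show ?thesis
    by (simp add: measurable_count_space_eq2_countable)
qed

lemma emeasure_cell_le:
  fixes K :: "'n::finite \<Rightarrow> int"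
  shows "emeasure lborel {x. cell m x = K} \<le> ennreal ((1 / 3 ^ CARD('n)) ^ m)"
proof -
  let ?a = "\<chi> i. K i / 3 ^ m" and ?b = "\<chi> i. (K i + 1) / 3 ^ m"
  have "x \<in> cbox ?a ?b" if "cell m x = K" for x
    unfolding mem_box_cart
  proof
    fix i
    have "\<lfloor>3 ^ m * x $ i\<rfloor> = K i"
      using that by (auto simp: cell_def)
    then have "K i \<le> 3 ^ m * x $ i" "3 ^ m * x $ i \<le> K i + 1"
      by linarith+
    then show "?a $ i \<le> x $ i \<and> x $ i \<le> ?b $ i"
      by (simp add: field_simps)
  qed
  then have "emeasure lborel {x. cell m x = K} \<le> emeasure lborel (cbox ?a ?b)"
    by (intro emeasure_mono) auto
  also have "\<dots> = ennreal (measure lborel (cbox ?a ?b))"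
    by (rule emeasure_eq_ennreal_measure) (simp add: emeasure_lborel_cbox_eq)
  also have "cbox ?a ?b \<noteq> {}"
    by (simp add: interval_ne_empty_cart divide_right_mono)
  then have "measure lborel (cbox ?a ?b) = (\<Prod>i\<in>(UNIV::'n set). 1 / 3 ^ m)"
    by (simp add: content_cbox_cart flip: diff_divide_distrib)
  also have "\<dots> = (1 / 3 ^ CARD('n)) ^ m"
    by (simp add: power_divide flip: power_mult)
  finally show ?thesis .
qed

text \<open>For \<open>0 < \<tau> < 1\<close> the inequality says
  \<open>core_level m x > m * log 2 (1 / \<tau>)\<close>, a positive proportion of the levels. The
  exponential form combines directly with counts and diameters.\<close>

definition good_points :: "real \<Rightarrow> (real ^ 'n) set" where
  "good_points \<tau> = {x. \<forall>\<^sub>F m in sequentially. (1 / 2) ^ core_level m x < \<tau> ^ m}"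

lemma core_level_measurable [measurable]: "core_level m \<in> borel \<rightarrow>\<^sub>M count_space UNIV"
  unfolding core_level_def by measurable

lemma good_points_borel: "good_points \<tau> \<in> sets borel"
  unfolding good_points_def by measurable

lemma emeasure_not_good_points:
  fixes \<tau> :: real
  assumes "1 - 1 / (2 * 3 ^ CARD('n)) < \<tau>"
  shows "emeasure lborel (UNIV - good_points \<tau> :: (real ^ 'n) set) = 0"
proof -
  define A where "A = (3::real) ^ CARD('n)"
  have A: "1 \<le> A"
    by (simp add: A_def)
  have \<tau>A: "A - 1 / 2 < \<tau> * A"
    using assms A unfolding A_def[symmetric] by (simp add: field_simps)
  with A have "0 < \<tau> * A"
    by linarith
  then have \<tau>: "0 < \<tau>"
    using A by (simp add: zero_less_mult_iff)
  \<comment> \<open>At most \<open>((A - 1/2) / \<tau>)^m\<close> sparse cubes, each of volume at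
    most \<open>A^(-m)\<close>, have total volume at most \<open>\<theta>^m\<close>. The hypothesis
    on \<open>\<tau>\<close> says that \<open>\<theta> < 1\<close>, as Borel-Cantelli
    requires.\<close>
  define \<theta> where "\<theta> = (A - 1 / 2) / (\<tau> * A)"
  have \<theta>: "0 \<le> \<theta>" "\<theta> < 1"
    using A \<tau> \<tau>A by (auto simp: \<theta>_def divide_less_eq)
  \<comment> \<open>Within one unit cube only finitely many cubes of each level occur, and there are
    countably many unit cubes.\<close>
  have "AE x :: real ^ 'n in lborel. cell 0 x = v \<longrightarrow> x \<in> good_points \<tau>" for v
  proof -
    define B where "B m = {x. cell 0 x = v \<and> \<tau> ^ m \<le> (1 / 2) ^ core_level m x}" for m
    have B: "B m \<in> sets lborel" for m
      unfolding B_def by measurable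
    have le: "emeasure lborel (B m) \<le> ennreal (\<theta> ^ m)" for m
    proof -
      let ?S = "{K \<in> subcells m v. \<tau> ^ m \<le> (1 / 2) ^ core_count m K}"
      have fin: "finite ?S"
        by (rule finite_subset[OF _ finite_subcells]) auto
      have "B m = (\<Union>K\<in>?S. {x. cell m x = K})"
        using cell_in_subcells[of m _ v] by (auto simp: B_def core_level_def)
      then have "emeasure lborel (B m) \<le> (\<Sum>K\<in>?S. emeasure lborel {x. cell m x = K})"
        using fin by (simp only:) (rule emeasure_subadditive_finite, auto)
      also have "\<dots> \<le> (\<Sum>K\<in>?S. ennreal ((1 / A) ^ m))"
        unfolding A_def by (intro sum_mono emeasure_cell_le)
      also have "\<dots> = ennreal (card ?S * (1 / A) ^ m)"
        using A by (simp add: ennreal_mult ennreal_of_nat_eq_real_of_nat)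
      also have "\<dots> \<le> ennreal (((A - 1 / 2) / \<tau>) ^ m * (1 / A) ^ m)"
        using card_sparse_subcells[OF \<tau>, of m v, folded A_def] A
        by (intro ennreal_leI mult_right_mono) auto
      also have "((A - 1 / 2) / \<tau>) ^ m * (1 / A) ^ m = \<theta> ^ m"
        by (simp add: \<theta>_def flip: power_mult_distrib)
      finally show ?thesis .
    qed
    have "emeasure lborel (B m) < \<infinity>" for m
      using le[of m] by (simp add: le_less_trans)
    moreover have "summable (\<lambda>m. measure lborel (B m))"
    proof (rule summable_comparison_test')
      show "summable (\<lambda>m. \<theta> ^ m)"
        using \<theta> by (simp add: summable_geometric)
      show "norm (measure lborel (B m)) \<le> \<theta> ^ m" if "0 \<le> m" for m
        using enn2real_mono[OF le[of m]] \<theta> by (simp add: measure_def)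
    qed
    ultimately have "AE x in lborel. \<forall>\<^sub>F m in sequentially. x \<in> space lborel - B m"
      using B by (intro borel_cantelli_AE1)
    then show ?thesis
    proof (rule eventually_mono, intro impI)
      fix x assume "\<forall>\<^sub>F m in sequentially. x \<in> space lborel - B m" and "cell 0 x = v"
      then show "x \<in> good_points \<tau>"
        unfolding good_points_def by (auto elim!: eventually_mono simp: B_def not_le)
    qed
  qed
  then have "AE x :: real ^ 'n in lborel. \<forall>v. cell 0 x = v \<longrightarrow> x \<in> good_points \<tau>"
    by (subst AE_all_countable) auto
  then have "AE x :: real ^ 'n in lborel. x \<notin> UNIV - good_points \<tau>"
    by (rule eventually_mono) auto
  then show ?thesis
    using good_points_borel[of \<tau>] by (subst (asm) AE_iff_null_sets[symmetric]) (auto simp: null_sets_def)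
qed

section \<open>Hausdorff measure of the good points\<close>

lemma hausdorff_premeasure_le_finite:
  assumes "finite F" and "\<And>K. K \<in> F \<Longrightarrow> U K \<subseteq> mspace X" "\<And>K. K \<in> F \<Longrightarrow> ediam X (U K) \<le> ennreal \<delta>"
    and "A \<subseteq> (\<Union>K\<in>F. U K)"
  shows "hausdorff_premeasure X s \<delta> A \<le> (\<Sum>K\<in>F. diam_power X s (U K))"
proof -
  obtain h where h: "bij_betw h {0..<card F} F"
    using ex_bij_betw_nat_finite[OF \<open>finite F\<close>] by blast
  \<comment> \<open>The finite cover is padded with empty sets, to which \<open>diam_power\<close>
    assigns 0 even for \<open>s = 0\<close>.\<close>
  define V where "V i = (if i < card F then U (h i) else {})" for i
  have hF: "h i \<in> F" if "i < card F" for i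
    using h that by (auto simp: bij_betw_def)
  have "hausdorff_premeasure X s \<delta> A \<le> (\<Sum>i. diam_power X s (V i))"
    unfolding hausdorff_premeasure_def
  proof (intro Inf_lower CollectI exI[of _ V] conjI allI refl)
    show "V i \<subseteq> mspace X" "ediam X (V i) \<le> ennreal \<delta>" for i
      using assms hF by (auto simp: V_def ediam_def)
    have "(\<Union>K\<in>F. U K) \<subseteq> (\<Union>i. V i)"
    proof (rule UN_least)
      fix K assume "K \<in> F"
      then obtain i where "i < card F" "h i = K"
        using h by (metis bij_betw_imp_surj_on imageE atLeastLessThan_iff)
      then show "U K \<subseteq> (\<Union>i. V i)"
        by (auto simp: V_def)
    qed
    with assms(4) show "A \<subseteq> (\<Union>i. V i)"
      by (rule order_trans)
  qed
  also have "\<dots> = (\<Sum>i\<in>{0..<card F}. diam_power X s (V i))"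
    by (rule suminf_finite) (auto simp: V_def diam_power_def)
  also have "\<dots> = (\<Sum>i\<in>{0..<card F}. diam_power X s (U (h i)))"
    by (simp add: V_def)
  also have "\<dots> = (\<Sum>K\<in>F. diam_power X s (U K))"
    by (rule sum.reindex_bij_betw[OF h])
  finally show ?thesis .
qed

text \<open>Each \<open>A i\<close> has a cover with sum below
  \<open>\<epsilon> / 2^(i + 1)\<close>; the double sequence of covering sets is enumerated by
  \<open>prod_decode\<close>.\<close>

lemma hausdorff_premeasure_UN_null:
  assumes "\<And>i :: nat. hausdorff_premeasure X s \<delta> (A i) = 0"
  shows "hausdorff_premeasure X s \<delta> (\<Union>i. A i) = 0"
proof -
  have le: "hausdorff_premeasure X s \<delta> (\<Union>i. A i) \<le> 0 + ennreal \<epsilon>" if "0 < \<epsilon>" for \<epsilon>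
  proof -
    have "\<exists>U. (\<forall>j :: nat. U j \<subseteq> mspace X \<and> ediam X (U j) \<le> ennreal \<delta>) \<and> A i \<subseteq> (\<Union>j. U j)
        \<and> (\<Sum>j. diam_power X s (U j)) < ennreal (\<epsilon> * (1 / 2) ^ Suc i)" for i
    proof -
      have "hausdorff_premeasure X s \<delta> (A i) < ennreal (\<epsilon> * (1 / 2) ^ Suc i)"
        using assms that by simp
      then show ?thesis
        unfolding hausdorff_premeasure_def Inf_less_iff by blast
    qed
    then obtain U where U: "\<And>i j. U i j \<subseteq> mspace X" "\<And>i j. ediam X (U i j) \<le> ennreal \<delta>"
      "\<And>i. A i \<subseteq> (\<Union>j :: nat. U i j)"
      "\<And>i. (\<Sum>j. diam_power X s (U i j)) < ennreal (\<epsilon> * (1 / 2) ^ Suc i)"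
      by metis
    define V where "V k = (case prod_decode k of (i, j) \<Rightarrow> U i j)" for k
    have "hausdorff_premeasure X s \<delta> (\<Union>i. A i) \<le> (\<Sum>k. diam_power X s (V k))"
      unfolding hausdorff_premeasure_def
    proof (intro Inf_lower CollectI exI[of _ V] conjI allI refl)
      show "V k \<subseteq> mspace X" "ediam X (V k) \<le> ennreal \<delta>" for k
        using U(1,2) by (auto simp: V_def split: prod.splits)
      show "(\<Union>i. A i) \<subseteq> (\<Union>k. V k)"
      proof
        fix x assume "x \<in> (\<Union>i. A i)"
        then obtain i j where "x \<in> U i j"
          using U(3) by blast
        then have "x \<in> V (prod_encode (i, j))"
          by (simp add: V_def)
        then show "x \<in> (\<Union>k. V k)" by blast
      qed
    qed
    also have "\<dots> = (\<Sum>k. (case prod_decode k of (i, j) \<Rightarrow> diam_power X s (U i j)))"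
      by (simp add: V_def case_prod_beta)
    also have "\<dots> = (\<Sum>i. \<Sum>j. diam_power X s (U i j))"
      using suminf_ennreal_2dimen[of "\<lambda>i. \<Sum>j. diam_power X s (U i j)" "\<lambda>(i, j). diam_power X s (U i j)"]
      by simp
    also have "\<dots> \<le> (\<Sum>i. ennreal (\<epsilon> * (1 / 2) ^ Suc i))"
      by (intro suminf_le less_imp_le[OF U(4)]) simp_all
    also have "\<dots> = ennreal (\<epsilon> * 1)"
    proof (rule suminf_ennreal_eq)
      show "0 \<le> \<epsilon> * (1 / 2) ^ Suc i" for i
        using that by simp
      show "(\<lambda>i. \<epsilon> * (1 / 2) ^ Suc i) sums (\<epsilon> * 1)"
        by (rule sums_mult[OF power_half_series])
    qed
    finally show ?thesis by simp
  qed
  have "hausdorff_premeasure X s \<delta> (\<Union>i. A i) \<le> 0"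
    by (rule ennreal_le_epsilon) (rule le)
  then show ?thesis by simp
qed

text \<open>A cube of level \<open>m\<close> has Euclidean diameter at most \<open>3^(r - m)\<close>
  for a fixed \<open>r\<close>, so weights of level \<open>m - r\<close> bound the distance, and
  they exceed those of level \<open>m\<close> by at most a constant factor.\<close>

lemma weight_dist_cell_le:
  "\<exists>C>0. \<forall>m (x :: real ^ 'n) y. cell m x = cell m y \<longrightarrow>
    weight_dist e x y \<le> C * ((1 / 2) ^ core_level m x) ^ e"
proof -
  obtain r where r: "real CARD('n) < 3 ^ r"
    using real_arch_pow[of 3 "real CARD('n)"] by auto
  define C :: real where "C = 2 * 2 ^ (Suc e * r)"
  have "weight_dist e x y \<le> C * ((1 / 2) ^ core_level m x) ^ e"
    if xy: "cell m x = cell m y" for m and x y :: "real ^ 'n"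
  proof -
    have "\<bar>x $ i - y $ i\<bar> \<le> 1 / 3 ^ m" for i
    proof -
      have "\<lfloor>3 ^ m * x $ i\<rfloor> = \<lfloor>3 ^ m * y $ i\<rfloor>"
        using fun_cong[OF xy, of i] by (simp add: cell_def)
      then have "\<bar>3 ^ m * x $ i - 3 ^ m * y $ i\<bar> \<le> 1"
        by linarith
      then have "3 ^ m * \<bar>x $ i - y $ i\<bar> \<le> 1"
        by (simp add: abs_mult flip: right_diff_distrib)
      then show ?thesis by (simp add: field_simps)
    qed
    then have "(\<Sum>i\<in>UNIV. \<bar>(x - y) $ i\<bar>) \<le> (\<Sum>i\<in>(UNIV :: 'n set). 1 / 3 ^ m)"
      by (intro sum_mono) simp
    then have "dist x y \<le> CARD('n) / 3 ^ m"
      using norm_le_l1_cart[of "x - y"] by (simp add: dist_norm)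
    also have "\<dots> \<le> 3 ^ r / 3 ^ m"
      using r by (intro divide_right_mono) auto
    also have "\<dots> = 3 powi (- (int m - int r))"
      by (simp add: power_int_diff)
    finally have "weight_dist e x y \<le> weight e (int m - int r) x + weight e (int m - int r) y"
      by (rule weight_dist_le)
    moreover have "weight e (int m - int r) z \<le> 2 ^ (Suc e * r) * ((1 / 2) ^ core_level m z) ^ e" for z :: "real ^ 'n"
    proof -
      have "weight e (int m - int r) z \<le> 2 powi (int (Suc e) * int r) * weight e (int m) z"
        using weight_growth[of "int m - int r" "int m" e z] by simp
      also have "2 powi (int (Suc e) * int r) = (2 ^ (Suc e * r) :: real)"
        by (simp only: of_nat_mult[symmetric] power_int_of_nat)
      also have "weight e (int m) z = (1 / 2) ^ m * ((1 / 2) ^ core_level m z) ^ e"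
      proof -
        have "weight e (int m) z = 2 powi (- int (m + e * core_level m z))"
          by (simp add: weight_def)
        also have "\<dots> = (1 / 2) ^ (m + e * core_level m z)"
          by (simp only: power_int_minus power_int_of_nat) (simp add: power_one_over inverse_eq_divide)
        finally show ?thesis
          by (simp add: power_add power_mult mult.commute[of e])
      qed
      \<comment> \<open>The factor \<open>2^(-m)\<close> is given away: middle subcubes alone make
        the diameters small enough.\<close>
      also have "2 ^ (Suc e * r) * ((1 / 2) ^ m * ((1 / 2) ^ core_level m z) ^ e)
          \<le> 2 ^ (Suc e * r) * (1 * ((1 / 2) ^ core_level m z) ^ e :: real)"
        by (intro mult_left_mono mult_right_mono power_le_one) auto
      finally show ?thesis by simp
    qed
    note this[of x] this[of y]
    moreover have "core_level m y = core_level m x"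
      using xy by (simp add: core_level_def)
    ultimately show ?thesis
      by (simp add: C_def)
  qed
  moreover have "C > 0"
    by (simp add: C_def)
  ultimately show ?thesis by blast
qed

text \<open>For every large \<open>m\<close> the set is covered by at most
  \<open>3^(CARD('n) m)\<close> cubes of diameter at most \<open>C * \<tau>^(e m)\<close>. The sum
  of their powers is at most a constant times the \<open>m\<close>-th power of a number below
  1.\<close>

lemma hausdorff_premeasure_good_cell:
  fixes v :: "'n::finite \<Rightarrow> int"
  assumes s: "0 < s" and \<tau>: "0 < \<tau>" "\<tau> < 1" and e: "3 ^ CARD('n) * (\<tau> powr s) ^ e < 1" and \<delta>: "0 < \<delta>"
  shows "hausdorff_premeasure (weight_metric e) s \<delta>
    {x. cell 0 x = v \<and> (\<forall>m\<ge>M. (1 / 2) ^ core_level m x < \<tau> ^ m)} = 0" (is "hausdorff_premeasure _ _ _ ?E = 0")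
proof -
  let ?A = "3 ^ CARD('n) :: real"
  obtain C where C: "C > 0" "\<And>m (x :: real ^ 'n) y. cell m x = cell m y \<Longrightarrow>
      weight_dist e x y \<le> C * ((1 / 2) ^ core_level m x) ^ e"
    using weight_dist_cell_le[where 'n = 'n, of e] by blast
  \<comment> \<open>A positive \<open>e\<close> makes the diameters fall below
    \<open>\<delta>\<close>.\<close>
  have "e \<noteq> 0"
  proof
    assume "e = 0"
    with e have "3 ^ CARD('n) < (1::real)" by simp
    moreover have "(1::real) \<le> 3 ^ CARD('n)" by simp
    ultimately show False by linarith
  qed
  then have \<tau>e: "\<tau> ^ e < 1"
    using \<tau> by (simp add: power_less_one_iff)
  have "(\<lambda>m. C * (\<tau> ^ e) ^ m) \<longlonglongrightarrow> C * 0"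
    using \<tau> \<tau>e by (intro tendsto_mult tendsto_const LIMSEQ_realpow_zero) auto
  then have "\<forall>\<^sub>F m in sequentially. C * (\<tau> ^ e) ^ m < \<delta>"
    using \<delta> by (auto dest: order_tendstoD(2))
  then have small: "\<forall>\<^sub>F m in sequentially. M \<le> m \<and> C * (\<tau> ^ e) ^ m < \<delta>"
    using eventually_ge_at_top by (rule eventually_conj[rotated])
  have bound: "hausdorff_premeasure (weight_metric e) s \<delta> ?E
      \<le> ennreal (C powr s * (?A * (\<tau> powr s) ^ e) ^ m)"
    if m: "M \<le> m \<and> C * (\<tau> ^ e) ^ m < \<delta>" for m
  proof -
    let ?F = "{K \<in> subcells m v. (1 / 2) ^ core_count m K < \<tau> ^ m}"
    let ?U = "\<lambda>K. {x :: real ^ 'n. cell m x = K}"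
    have diam: "ediam (weight_metric e) (?U K) \<le> ennreal (C * (\<tau> ^ e) ^ m)" if "K \<in> ?F" for K
      unfolding ediam_def
    proof (intro SUP_least)
      fix x y assume xy: "x \<in> ?U K" "y \<in> ?U K"
      have "weight_dist e x y \<le> C * ((1 / 2) ^ core_level m x) ^ e"
        using xy by (intro C) simp
      also have "\<dots> \<le> C * (\<tau> ^ m) ^ e"
        using that xy C(1) by (intro mult_left_mono power_mono) (auto simp: core_level_def)
      finally show "ennreal (mdist (weight_metric e) x y) \<le> ennreal (C * (\<tau> ^ e) ^ m)"
        by (simp add: ennreal_leI mult.commute flip: power_mult)
    qed
    have "hausdorff_premeasure (weight_metric e) s \<delta> ?E \<le> (\<Sum>K\<in>?F. diam_power (weight_metric e) s (?U K))"
    proof (rule hausdorff_premeasure_le_finite)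
      show "finite ?F"
        by (rule finite_subset[OF _ finite_subcells]) auto
      show "ediam (weight_metric e) (?U K) \<le> ennreal \<delta>" if "K \<in> ?F" for K
        using diam[OF that] m by (meson ennreal_leI less_imp_le order_trans)
      show "?E \<subseteq> (\<Union>K\<in>?F. ?U K)"
        using m by (auto simp: cell_in_subcells core_level_def)
    qed auto
    also have "\<dots> \<le> (\<Sum>K\<in>?F. ennreal ((C * (\<tau> ^ e) ^ m) powr s))"
    proof (rule sum_mono)
      fix K assume "K \<in> ?F"
      have "enn2real (ediam (weight_metric e) (?U K)) \<le> C * (\<tau> ^ e) ^ m"
        using enn2real_mono[OF diam[OF \<open>K \<in> ?F\<close>]] C(1) \<tau> by simp
      then have "enn2real (ediam (weight_metric e) (?U K)) powr s \<le> (C * (\<tau> ^ e) ^ m) powr s"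
        using s by (intro powr_mono2) auto
      then show "diam_power (weight_metric e) s (?U K) \<le> ennreal ((C * (\<tau> ^ e) ^ m) powr s)"
        using s by (auto simp: diam_power_def intro: ennreal_leI)
    qed
    also have "\<dots> = ennreal (card ?F * (C * (\<tau> ^ e) ^ m) powr s)"
      by (simp add: ennreal_mult ennreal_of_nat_eq_real_of_nat)
    \<comment> \<open>Counting all subcubes suffices, since the hypothesis on \<open>e\<close>
      outweighs their number.\<close>
    also have "\<dots> \<le> ennreal (?A ^ m * (C * (\<tau> ^ e) ^ m) powr s)"
    proof (intro ennreal_leI mult_right_mono)
      have "card ?F \<le> card (subcells m v)"
        by (intro card_mono finite_subcells) auto
      then have "real (card ?F) \<le> real (card (subcells m v))"
        by (rule of_nat_mono)
      then show "real (card ?F) \<le> ?A ^ m"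
        by (simp add: card_subcells)
    qed auto
    also have "(C * (\<tau> ^ e) ^ m) powr s = C powr s * ((\<tau> powr s) ^ e) ^ m"
      using C(1) \<tau> by (simp add: powr_mult powr_power powr_powr mult_ac flip: powr_realpow power_mult)
    also have "?A ^ m * (C powr s * ((\<tau> powr s) ^ e) ^ m) = C powr s * (?A * (\<tau> powr s) ^ e) ^ m"
      by (simp add: power_mult_distrib)
    finally show ?thesis .
  qed
  have "(\<lambda>m. ennreal (C powr s * (?A * (\<tau> powr s) ^ e) ^ m)) \<longlonglongrightarrow> ennreal (C powr s * 0)"
    using e by (intro tendsto_ennrealI tendsto_mult tendsto_const LIMSEQ_realpow_zero) auto
  moreover have "\<forall>\<^sub>F m in sequentially. hausdorff_premeasure (weight_metric e) s \<delta> ?E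
      \<le> ennreal (C powr s * (?A * (\<tau> powr s) ^ e) ^ m)"
    using small by (rule eventually_mono) (rule bound)
  ultimately have "hausdorff_premeasure (weight_metric e) s \<delta> ?E \<le> ennreal (C powr s * 0)"
    by (rule tendsto_lowerbound) simp
  then show ?thesis by simp
qed

text \<open>The condition defining good points becomes uniform on the countably many pieces given by
  a unit cube \<open>v\<close> and a threshold \<open>M\<close>, enumerated by
  \<open>from_nat\<close>.\<close>

lemma hausdorff_measure_good_points:
  assumes "0 < s" "0 < \<tau>" "\<tau> < 1" "3 ^ CARD('n) * (\<tau> powr s) ^ e < 1"
  shows "hausdorff_measure (weight_metric e) s (good_points \<tau> :: (real ^ 'n) set) = 0"
proof -
  define E :: "nat \<Rightarrow> (real ^ 'n) set" where "E k = (case from_nat k of (v, M) \<Rightarrow>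
    {x. cell 0 x = v \<and> (\<forall>m\<ge>M. (1 / 2) ^ core_level m x < \<tau> ^ m)})" for k
  have "good_points \<tau> = (\<Union>k. E k)"
  proof (intro equalityI subsetI)
    fix x :: "real ^ 'n" assume "x \<in> good_points \<tau>"
    then obtain M where M: "\<forall>m\<ge>M. (1 / 2) ^ core_level m x < \<tau> ^ m"
      by (auto simp: good_points_def eventually_sequentially)
    then have "x \<in> E (to_nat (cell 0 x, M))"
      by (simp add: E_def)
    then show "x \<in> (\<Union>k. E k)" by blast
  next
    fix x :: "real ^ 'n" assume "x \<in> (\<Union>k. E k)"
    then obtain k where "x \<in> E k" by blast
    then show "x \<in> good_points \<tau>"
      by (cases "from_nat k :: ('n \<Rightarrow> int) \<times> nat")
         (auto simp: good_points_def eventually_sequentially E_def)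
  qed
  moreover have "hausdorff_premeasure (weight_metric e) s \<delta> (\<Union>k. E k) = 0" if "0 < \<delta>" for \<delta>
  proof (rule hausdorff_premeasure_UN_null)
    show "hausdorff_premeasure (weight_metric e) s \<delta> (E k) = 0" for k
      unfolding E_def using hausdorff_premeasure_good_cell[OF assms that] by (simp split: prod.splits)
  qed
  ultimately show ?thesis
    unfolding hausdorff_measure_def by (simp add: SUP_eq_const)
qed

section \<open>Choice of the parameters\<close>

theorem corollary1p4:
  assumes "CARD('n::finite) \<ge> 2"
  shows "conformal_dimension (lborel :: (real ^ 'n) measure) = 0"
proof -
  \<comment> \<open>Any value strictly between \<open>1 - 1 / (2 * 3^CARD('n))\<close>, the
    threshold for full measure, and 1 would serve.\<close>
  define \<tau> :: real where "\<tau> = 1 - 1 / (4 * 3 ^ CARD('n))"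
  have "(1::real) \<le> 3 ^ CARD('n)"
    by simp
  then have "1 < 4 * (3::real) ^ CARD('n)"
    by linarith
  then have \<tau>: "0 < \<tau>" "\<tau> < 1" "1 - 1 / (2 * 3 ^ CARD('n)) < \<tau>"
    by (auto simp: \<tau>_def field_simps)
  have le: "conformal_dimension (lborel :: (real ^ 'n) measure) \<le> 0 + ennreal s" if "0 < s" for s
  proof -
    have "\<tau> powr s < 1"
      using powr_less_mono2[of s \<tau> 1] \<tau> that by simp
    \<comment> \<open>Only the metric depends on \<open>s\<close>, through \<open>e\<close>; the set
      of full measure is the same for all \<open>s\<close>.\<close>
    then obtain e where "(\<tau> powr s) ^ e < 1 / 3 ^ CARD('n)"
      using real_arch_pow_inv[of "1 / 3 ^ CARD('n)" "\<tau> powr s"] by auto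
    then have "3 ^ CARD('n) * (\<tau> powr s) ^ e < 1"
      by (simp add: field_simps)
    then have "hausdorff_measure (weight_metric e) s (good_points \<tau> :: (real ^ 'n) set) = 0"
      by (intro hausdorff_measure_good_points that \<tau>)
    then have "hausdorff_dim (weight_metric e) (good_points \<tau> :: (real ^ 'n) set) \<le> ennreal s"
      unfolding hausdorff_dim_def using that by (intro Inf_lower) auto
    moreover have "conformal_dimension (lborel :: (real ^ 'n) measure)
        \<le> hausdorff_dim (weight_metric e) (id ` (good_points \<tau> :: (real ^ 'n) set))"
      by (rule conformal_dimension_le[OF quasisymmetric_weight_metric good_points_borel
            emeasure_not_good_points[OF \<tau>(3)]])
    ultimately show ?thesis by simp
  qed
  have "conformal_dimension (lborel :: (real ^ 'n) measure) \<le> 0"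
    by (rule ennreal_le_epsilon) (rule le)
  then show ?thesis by simp
qed

end
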